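(* Let $d>2$, $n,H\ge 1$, and consider the depth-$d$ network with linear (identity) activations, $$f_{(\mathcal W,\mathcal B)}(\vec x)=\vec W_d\big(\vec W_{d-1}(\cdots(\vec W_1\vec x+\vec b_1)\cdots)+\vec b_{d-1}\big)+\vec b_d,\qquad \vec x\in\mathbb R^n .$$ Let $(\mathcal Z,\mathcal C)$ be a random Xavier initialization of this network (Gaussian weights $\mathcal Z$, zero biases $\mathcal C=0$). Then with high probability over the draw of $\mathcal Z$, for every $r\ge 0$, every $m\ge1$ and all points $\vec x_1,\dots,\vec x_m\in\mathbb R^n$, $$\frac1m\,\mathbb E_{\vec\xi}\left[\sup_{(\mathcal W,\mathcal B):\ \|(\mathcal Z,\mathcal C)-(\mathcal W,\mathcal B)\|_F\le r}\ \sum_{i=1}^m \xi_i f_{(\mathcal W,\mathcal B)}(\vec x_i)\right]=\tilde{\mathcal O}\left(\frac{d\,c^d\,(r+1)^d\,\max_i\|\vec x_i\|}{\sqrt m}\right),$$ where $c=\tilde\Theta(1)$ and $\vec\xi=(\xi_1,\dots,\xi_m)$ is uniform on $\{-1,1\}^m$. In particular the bound does not depend on $H$ except through logarithmic factors.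
   Context: Parameters: $\mathcal W=\{\vec W_1,\dots,\vec W_d\}$ and $\mathcal B=\{\vec b_1,\dots,\vec b_d\}$ with $\vec W_1\in\mathbb R^{H\times n}$, $\vec W_k\in\mathbb R^{H\times H}$ for $1<k<d$, $\vec W_d\in\mathbb R^{1\times H}$, $\vec b_k\in\mathbb R^H$ for $k<d$, $\vec b_d\in\mathbb R$ (single output). Xavier initialization: $(\mathcal Z,\mathcal C)$ has the same shapes as $(\mathcal W,\mathcal B)$; all entries of the matrices $\vec Z_k$ are independent centered Gaussians with standard deviation $\Theta(1/\sqrt H)$ (between $a_1/\sqrt H$ and $a_2/\sqrt H$ for fixed constants $0<a_1\le a_2$, with a common value within each layer), and all biases $\vec c_k$ in $\mathcal C$ are $0$. Distance: $\|(\mathcal W,\mathcal B)-(\mathcal Z,\mathcal C)\|_F=\sqrt{\sum_{k=1}^d\|\vec W_k-\vec Z_k\|_F^2+\|\vec b_k-\vec c_k\|^2}$, where $\|\cdot\|_F$ on matrices is the Frobenius norm and $\|\cdot\|$ is the Euclidean norm of a vector. Asymptotic conventions: "with high probability" means with probability at least $1-\delta$ for any given $\delta\in(0,1)$; $\tilde{\mathcal O},\tilde\Theta$ hide constants and factors polylogarithmic in $H,d,m,1/\delta$. The input dimension $n$ and the constants $a_1,a_2$ are regarded as fixed, so hidden constants may depend on them, but not on $H,d,m,r$ or the $\vec x_i$.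
   Formalization: The factor max_i ‖x_i‖ is replaced by max{1, max_i ‖x_i‖}, because the output bias makes the literal bound false for zero or very small inputs (m=1, x_1=0, r=1 gives left side at least 1 and right side 0). *)

theory Defs
  imports "HOL-Probability.Probability" "Jordan_Normal_Form.Matrix"
begin

hide_const (open) Finite_Cartesian_Product.vec Finite_Cartesian_Product.mat
hide_type (open) Finite_Cartesian_Product.vec
no_notation vec_nth (infixl \<open>$\<close> 90)
no_notation inner (infix \<open>\<bullet>\<close> 70)

section \<open>Depth-d linear networks of width H on inputs of dimension n, with one output\<close>

text \<open>Parameters are families indexed by the layers 1, ..., d; values at other
  indices are irrelevant.\<close>

type_synonym params = "(nat \<Rightarrow> real mat) \<times> (nat \<Rightarrow> real vec)"

definition fan_in :: "nat \<Rightarrow> nat \<Rightarrow> nat \<Rightarrow> nat" where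
  "fan_in n H k = (if k = 1 then n else H)"

definition fan_out :: "nat \<Rightarrow> nat \<Rightarrow> nat \<Rightarrow> nat" where
  "fan_out d H k = (if k = d then 1 else H)"

definition param_space :: "nat \<Rightarrow> nat \<Rightarrow> nat \<Rightarrow> params set" where
  "param_space n d H = {(W, b). \<forall>k\<in>{1..d}.
     W k \<in> carrier_mat (fan_out d H k) (fan_in n H k) \<and> b k \<in> carrier_vec (fan_out d H k)}"

primrec layer_output :: "params \<Rightarrow> real vec \<Rightarrow> nat \<Rightarrow> real vec" where
  "layer_output p x 0 = x"
| "layer_output p x (Suc k) = fst p (Suc k) *\<^sub>v layer_output p x k + snd p (Suc k)"

definition net :: "nat \<Rightarrow> params \<Rightarrow> real vec \<Rightarrow> real" where
  "net d p x = layer_output p x d $ 0"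

definition euclidean_norm :: "real vec \<Rightarrow> real" where
  "euclidean_norm v = sqrt (v \<bullet> v)"

definition frobenius_norm :: "real mat \<Rightarrow> real" where
  "frobenius_norm A = sqrt (\<Sum>i<dim_row A. \<Sum>j<dim_col A. (A $$ (i, j))\<^sup>2)"

definition param_dist :: "nat \<Rightarrow> params \<Rightarrow> params \<Rightarrow> real" where
  "param_dist d p q = sqrt (\<Sum>k=1..d. (frobenius_norm (fst p k - fst q k))\<^sup>2
                                     + (euclidean_norm (snd p k - snd q k))\<^sup>2)"

definition param_ball :: "nat \<Rightarrow> nat \<Rightarrow> nat \<Rightarrow> params \<Rightarrow> real \<Rightarrow> params set" where
  "param_ball n d H p\<^sub>0 r = {p \<in> param_space n d H. param_dist d p\<^sub>0 p \<le> r}"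

section \<open>Xavier initialization\<close>

text \<open>A sample is the family of all weight entries, indexed by (layer, row, column).\<close>

definition weight_index :: "nat \<Rightarrow> nat \<Rightarrow> nat \<Rightarrow> (nat \<times> nat \<times> nat) set" where
  "weight_index n d H = {(k, i, j). k \<in> {1..d} \<and> i < fan_out d H k \<and> j < fan_in n H k}"

definition xavier_measure ::
    "nat \<Rightarrow> nat \<Rightarrow> nat \<Rightarrow> (nat \<Rightarrow> real) \<Rightarrow> (nat \<times> nat \<times> nat \<Rightarrow> real) measure" where
  "xavier_measure n d H \<sigma> =
     (\<Pi>\<^sub>M (k, i, j)\<in>weight_index n d H. density lborel (normal_density 0 (\<sigma> k)))"

definition xavier_params :: "nat \<Rightarrow> nat \<Rightarrow> nat \<Rightarrow> (nat \<times> nat \<times> nat \<Rightarrow> real) \<Rightarrow> params" where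
  "xavier_params n d H \<omega> =
     (\<lambda>k. mat (fan_out d H k) (fan_in n H k) (\<lambda>(i, j). \<omega> (k, i, j)),
      \<lambda>k. 0\<^sub>v (fan_out d H k))"

section \<open>Empirical Rademacher complexity\<close>

definition sign_vectors :: "nat \<Rightarrow> (nat \<Rightarrow> real) set" where
  "sign_vectors m = {..<m} \<rightarrow>\<^sub>E {-1, 1}"

text \<open>The points are x 0, ..., x (m - 1).
  For the balls above with r nonnegative, the supremum ranges over a nonempty bounded set
  of reals, so it is the genuine supremum.

  The output bias does not vanish with the inputs: if all inputs are 0, the complexity of the
  r-ball is at least r times the mean of the absolute value of a normalised Rademacher sum,
  which is positive for positive r. A bound on the r-ball proportional to the largest input
  norm is therefore impossible; the input scale has to be bounded away from 0, as in
  the maximum of 1 and the largest input norm.\<close>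

definition rademacher_complexity ::
    "nat \<Rightarrow> params set \<Rightarrow> nat \<Rightarrow> (nat \<Rightarrow> real vec) \<Rightarrow> real" where
  "rademacher_complexity d P m x = (1 / real m) *
     measure_pmf.expectation (pmf_of_set (sign_vectors m))
       (\<lambda>\<xi>. SUP p\<in>P. \<Sum>i<m. \<xi> i * net d p (x i))"

section \<open>Soft asymptotics in the width, depth, sample size and confidence\<close>

text \<open>The functions below take the arguments H, d, m and the failure probability.
  Since every logarithm is nonnegative on the admissible range, each polylogarithmic factor
  in the four quantities is bounded by a constant multiple of a power of their sum plus 1.\<close>

definition log_factor :: "nat \<Rightarrow> nat \<Rightarrow> nat \<Rightarrow> real \<Rightarrow> real" where
  "log_factor H d m \<delta> = 1 + ln (real H) + ln (real d) + ln (real m) + ln (1 / \<delta>)"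

definition soft_O_one :: "(nat \<Rightarrow> nat \<Rightarrow> nat \<Rightarrow> real \<Rightarrow> real) \<Rightarrow> bool" where
  "soft_O_one g \<longleftrightarrow> (\<exists>K p. \<forall>H\<ge>1. \<forall>d>2. \<forall>m\<ge>1. \<forall>\<delta>\<in>{0<..<1}.
     \<bar>g H d m \<delta>\<bar> \<le> K * log_factor H d m \<delta> ^ p)"

definition soft_Theta_one :: "(nat \<Rightarrow> nat \<Rightarrow> nat \<Rightarrow> real \<Rightarrow> real) \<Rightarrow> bool" where
  "soft_Theta_one g \<longleftrightarrow> soft_O_one g \<and> (\<exists>K>0. \<exists>p. \<forall>H\<ge>1. \<forall>d>2. \<forall>m\<ge>1. \<forall>\<delta>\<in>{0<..<1}.
     K / log_factor H d m \<delta> ^ p \<le> g H d m \<delta>)"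

end

theory Submission
  imports Defs
begin

text \<open>A signed sum of network outputs is obtained by pushing the signed sum of the inputs through the
  same linear layers, with the biases multiplied by the sum of the signs. Hence it is at most
  \<open>(s + r) ^ d\<close> times the sum of the norm of the signed input sum and d times the absolute value of
  the sum of the signs, as soon as \<open>s \<ge> 1\<close> bounds the operator norms of all initial weight matrices; second
  moments of the random signs then give the rate \<open>1 / sqrt m\<close>.

  The operator norms are controlled without epsilon nets. An exponential Markov inequality bounds
  \<open>u\<^sup>T Z v\<close> simultaneously for all u and v with entries in \<open>{-1, 0, 1}\<close>, of which there are only
  exponentially many in the width. Testing against such vectors determines a Euclidean norm up to the
  square root of a harmonic number, so the passage to arbitrary u and v costs one logarithm of the
  width.\<close>

section \<open>Operator norms from ternary test vectors\<close>

text \<open>The hypothesis on the set of the k largest absolute values bounds the k-th largest by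
  \<open>G / sqrt k\<close>.\<close>

lemma sum_square_le_harm:
  fixes w :: "'i \<Rightarrow> real"
  assumes "finite S" and "\<And>T. T \<subseteq> S \<Longrightarrow> (\<Sum>i\<in>T. \<bar>w i\<bar>) \<le> G * sqrt (card T)"
  shows "(\<Sum>i\<in>S. (w i)\<^sup>2) \<le> G\<^sup>2 * harm (card S)"
  using assms
proof (induction "card S" arbitrary: S)
  case 0
  then show ?case by (simp add: harm_expand)
next
  case (Suc N)
  have ne: "S \<noteq> {}" using Suc.hyps(2) by auto
  \<comment> \<open>An entry of least absolute value is at most the average over \<open>S\<close>,
    so its square is at most \<open>G^2 / Suc N\<close>. This is \<open>G^2\<close> times the term
    that \<open>harm\<close> gains from \<open>N\<close> to \<open>Suc N\<close>.\<close>
  obtain i where i: "i \<in> S" and min: "\<And>j. j \<in> S \<Longrightarrow> \<bar>w i\<bar> \<le> \<bar>w j\<bar>"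
    using arg_min_if_finite(1)[OF Suc.prems(1) ne, of "\<lambda>j. \<bar>w j\<bar>"]
      arg_min_least[OF Suc.prems(1) ne, of _ "\<lambda>j. \<bar>w j\<bar>"] by metis
  have cS: "card S = Suc N" and cT: "card (S - {i}) = N"
    using Suc.hyps(2) i by auto
  have "real (Suc N) * \<bar>w i\<bar> \<le> (\<Sum>j\<in>S. \<bar>w j\<bar>)"
    using sum_mono[of S "\<lambda>_. \<bar>w i\<bar>" "\<lambda>j. \<bar>w j\<bar>"] min cS by simp
  also have "\<dots> \<le> G * sqrt (Suc N)"
    using Suc.prems(2)[of S] cS by simp
  finally have "(real (Suc N) * \<bar>w i\<bar>)\<^sup>2 \<le> (G * sqrt (Suc N))\<^sup>2"
    by (rule power_mono) simp
  then have "real (Suc N) * (real (Suc N) * (w i)\<^sup>2) \<le> real (Suc N) * G\<^sup>2"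
    by (simp add: power_mult_distrib power2_eq_square algebra_simps del: of_nat_Suc)
  then have "real (Suc N) * (w i)\<^sup>2 \<le> G\<^sup>2"
    by (subst (asm) mult_le_cancel_left_pos) auto
  then have wi: "(w i)\<^sup>2 \<le> G\<^sup>2 / real (Suc N)"
    by (simp add: field_simps del: of_nat_Suc)
  have "(\<Sum>j\<in>S - {i}. (w j)\<^sup>2) \<le> G\<^sup>2 * harm (card (S - {i}))"
    using Suc.prems by (intro Suc.hyps(1)) (auto simp: cT)
  then show ?case
    using wi i Suc.prems(1) cS cT
    by (simp add: sum.remove[OF _ i] harm_Suc algebra_simps divide_inverse del: of_nat_Suc)
qed

text \<open>The difference \<open>harm N - ln N\<close> decreases in \<open>N\<close> and equals 1
  at \<open>N = 1\<close>.\<close>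

lemma harm_le_ln:
  assumes "N \<ge> 1"
  shows "(harm N :: real) \<le> 1 + ln (real N)"
proof -
  obtain k where k: "N = Suc k" using assms by (cases N) auto
  have "harm (Suc k) - ln (real (Suc k)) \<le> (harm (Suc 0) - ln (real (Suc 0)) :: real)"
    using decseq_harm_diff_ln[THEN decseqD, of 0 k] by simp
  then show ?thesis by (simp add: k harm_expand)
qed

text \<open>The sign pattern of \<open>w\<close> on a subset \<open>T\<close>, extended by 0, is a
  ternary vector of norm \<open>sqrt (card T)\<close>. Testing against it gives the subset
  hypothesis of \<open>sum_square_le_harm\<close>.\<close>

lemma L2_set_le_if_ternary_tests:
  fixes w :: "nat \<Rightarrow> real"
  assumes G: "G \<ge> 0" and N: "p \<le> N" "N \<ge> 1"
    and test: "\<And>v. v \<in> {..<p} \<rightarrow>\<^sub>E {-1, 0, 1} \<Longrightarrow> (\<Sum>i<p. v i * w i) \<le> G * L2_set v {..<p}"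
  shows "L2_set w {..<p} \<le> G * sqrt (1 + ln (real N))"
proof -
  have "(\<Sum>i<p. (w i)\<^sup>2) \<le> G\<^sup>2 * harm (card {..<p})"
  proof (rule sum_square_le_harm)
    fix T assume T: "T \<subseteq> {..<p}"
    \<comment> \<open>Zero entries of \<open>w\<close> inside \<open>T\<close> receive the sign 1,
      so that the norm of \<open>v\<close> is exactly \<open>sqrt (card T)\<close>.\<close>
    define v where "v = (\<lambda>i\<in>{..<p}. if i \<in> T then (if w i < 0 then -1 else 1) else (0::real))"
    have v: "v \<in> {..<p} \<rightarrow>\<^sub>E {-1, 0, 1}" by (auto simp: v_def)
    have "(\<Sum>i\<in>T. \<bar>w i\<bar>) = (\<Sum>i<p. if i \<in> T then \<bar>w i\<bar> else 0)"
      using T by (simp add: sum.If_cases Int_absorb1)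
    also have "\<dots> = (\<Sum>i<p. v i * w i)"
      by (rule sum.cong) (auto simp: v_def)
    also have "\<dots> \<le> G * L2_set v {..<p}" by (rule test[OF v])
    also have "(\<Sum>i<p. (v i)\<^sup>2) = (\<Sum>i<p. if i \<in> T then 1 else 0)"
      by (rule sum.cong) (auto simp: v_def)
    then have "L2_set v {..<p} = sqrt (card T)"
      using T by (simp add: L2_set_def sum.If_cases Int_absorb1)
    finally show "(\<Sum>i\<in>T. \<bar>w i\<bar>) \<le> G * sqrt (card T)" .
  qed simp
  also have "\<dots> \<le> G\<^sup>2 * (1 + ln (real N))"
    using harm_mono[OF N(1), where 'a = real] harm_le_ln[OF N(2)]
    by (intro mult_left_mono) auto
  finally have "L2_set w {..<p} \<le> sqrt (G\<^sup>2 * (1 + ln (real N)))"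
    unfolding L2_set_def by (rule real_sqrt_le_mono)
  then show ?thesis using G by (simp add: real_sqrt_mult)
qed

lemma sum_mult_le_L2_set: "(\<Sum>i\<in>A. f i * g i) \<le> L2_set f A * L2_set g A"
  using order_trans[OF sum_mono[of A "\<lambda>i. f i * g i" "\<lambda>i. \<bar>f i\<bar> * \<bar>g i\<bar>"] L2_set_mult_ineq]
  by (simp add: abs_mult[symmetric])

text \<open>The ternary criterion is used once per side. For fixed ternary \<open>u\<close> it
  bounds the row vector obtained from \<open>u\<close> and \<open>Z\<close>; Cauchy-Schwarz against
  \<open>y\<close> then makes \<open>u\<close> a test of the vector obtained from \<open>Z\<close>
  and \<open>y\<close>. Each use costs a square root of a logarithm, together one logarithm.\<close>

lemma L2_set_matrix_vector_le:
  fixes Z :: "nat \<Rightarrow> nat \<Rightarrow> real"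
  assumes G: "G \<ge> 0" and N: "p \<le> N" "q \<le> N" "N \<ge> 1"
    and test: "\<And>u v. u \<in> {..<p} \<rightarrow>\<^sub>E {-1, 0, 1} \<Longrightarrow> v \<in> {..<q} \<rightarrow>\<^sub>E {-1, 0, 1} \<Longrightarrow>
      (\<Sum>i<p. \<Sum>j<q. u i * Z i j * v j) \<le> G * L2_set u {..<p} * L2_set v {..<q}"
  shows "L2_set (\<lambda>i. \<Sum>j<q. Z i j * y j) {..<p} \<le> G * (1 + ln (real N)) * L2_set y {..<q}"
proof -
  let ?h = "sqrt (1 + ln (real N))"
  have h: "0 \<le> 1 + ln (real N)" using N(3) by simp
  have col: "L2_set (\<lambda>j. \<Sum>i<p. u i * Z i j) {..<q} \<le> G * L2_set u {..<p} * ?h"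
    if "u \<in> {..<p} \<rightarrow>\<^sub>E {-1, 0, 1}" for u
  proof (rule L2_set_le_if_ternary_tests[OF _ N(2,3)])
    fix v :: "nat \<Rightarrow> real" assume v: "v \<in> {..<q} \<rightarrow>\<^sub>E {-1, 0, 1}"
    have "(\<Sum>j<q. v j * (\<Sum>i<p. u i * Z i j)) = (\<Sum>i<p. \<Sum>j<q. u i * Z i j * v j)"
      by (subst sum.swap) (simp add: sum_distrib_left mult_ac)
    then show "(\<Sum>j<q. v j * (\<Sum>i<p. u i * Z i j)) \<le> G * L2_set u {..<p} * L2_set v {..<q}"
      using test[OF that v] by simp
  qed (use G in simp)
  have "L2_set (\<lambda>i. \<Sum>j<q. Z i j * y j) {..<p} \<le> (G * ?h * L2_set y {..<q}) * ?h"
  proof (rule L2_set_le_if_ternary_tests[OF _ N(1,3)])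
    fix u :: "nat \<Rightarrow> real" assume u: "u \<in> {..<p} \<rightarrow>\<^sub>E {-1, 0, 1}"
    have "(\<Sum>i<p. u i * (\<Sum>j<q. Z i j * y j)) = (\<Sum>j<q. (\<Sum>i<p. u i * Z i j) * y j)"
      by (simp add: sum_distrib_left sum_distrib_right mult_ac) (rule sum.swap)
    also have "\<dots> \<le> L2_set (\<lambda>j. \<Sum>i<p. u i * Z i j) {..<q} * L2_set y {..<q}"
      by (rule sum_mult_le_L2_set)
    also have "\<dots> \<le> (G * L2_set u {..<p} * ?h) * L2_set y {..<q}"
      by (intro mult_right_mono col[OF u]) simp
    finally show "(\<Sum>i<p. u i * (\<Sum>j<q. Z i j * y j)) \<le> G * ?h * L2_set y {..<q} * L2_set u {..<p}"
      by (simp add: mult_ac)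
  qed (use G h in simp)
  also have "\<dots> = G * (?h * ?h) * L2_set y {..<q}" by (simp only: mult_ac)
  finally show ?thesis using h by simp
qed

section \<open>Exponential moments of Gaussian linear forms\<close>

text \<open>Completing the square: tilting the density by \<open>exp (c * x)\<close> gives a
  multiple of the normal density with mean \<open>c * s^2\<close>, whose total mass is 1.\<close>

lemma nn_integral_exp_normal:
  assumes "s > 0"
  shows "(\<integral>\<^sup>+ x. ennreal (exp (c * x)) \<partial>density lborel (normal_density 0 s)) = ennreal (exp (c\<^sup>2 * s\<^sup>2 / 2))"
proof -
  have sq: "normal_density 0 s x * exp (c * x) = exp (c\<^sup>2 * s\<^sup>2 / 2) * normal_density (c * s\<^sup>2) s x" for x
  proof -
    have "- x\<^sup>2 / (2 * s\<^sup>2) + c * x = c\<^sup>2 * s\<^sup>2 / 2 + - (x - c * s\<^sup>2)\<^sup>2 / (2 * s\<^sup>2)"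
      using assms by (simp add: field_simps power2_eq_square)
    then show ?thesis
      unfolding normal_density_def
      by (simp add: mult.left_commute exp_add[symmetric] del: times_divide_eq_left)
  qed
  interpret N: prob_space "density lborel (normal_density (c * s\<^sup>2) s)"
    by (rule prob_space_normal_density[OF assms])
  have one: "(\<integral>\<^sup>+ x. ennreal (normal_density (c * s\<^sup>2) s x) \<partial>lborel) = 1"
    using N.emeasure_space_1 by (simp add: emeasure_density)
  have "(\<integral>\<^sup>+ x. ennreal (exp (c * x)) \<partial>density lborel (normal_density 0 s))
      = (\<integral>\<^sup>+ x. ennreal (normal_density 0 s x * exp (c * x)) \<partial>lborel)"
    by (subst nn_integral_density) (auto simp: ennreal_mult')
  also have "\<dots> = (\<integral>\<^sup>+ x. ennreal (exp (c\<^sup>2 * s\<^sup>2 / 2)) * ennreal (normal_density (c * s\<^sup>2) s x) \<partial>lborel)"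
    by (simp only: sq) (simp add: ennreal_mult')
  also have "\<dots> = ennreal (exp (c\<^sup>2 * s\<^sup>2 / 2))"
    by (subst nn_integral_cmult) (auto simp: one)
  finally show ?thesis .
qed

text \<open>By independence the exponential moment factors over the coordinates, and the variances
  add up in the exponent.\<close>

lemma nn_integral_exp_gaussian_form:
  assumes I: "finite I" and s: "\<And>i. i \<in> I \<Longrightarrow> s i > 0"
  shows "(\<integral>\<^sup>+ \<omega>. ennreal (exp (\<Sum>i\<in>I. c i * \<omega> i)) \<partial>(\<Pi>\<^sub>M i\<in>I. density lborel (normal_density 0 (s i))))
    = ennreal (exp ((\<Sum>i\<in>I. (c i)\<^sup>2 * (s i)\<^sup>2) / 2))"
proof -
  \<comment> \<open>The product locale asks for a sigma-finite measure at every index, so the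
    deviations are set to 1 outside \<open>I\<close>.\<close>
  define s' where "s' i = (if i \<in> I then s i else 1)" for i
  let ?N = "\<lambda>i. density lborel (normal_density 0 (s' i))"
  have s': "s' i > 0" for i using s by (simp add: s'_def)
  have eq: "(\<Pi>\<^sub>M i\<in>I. density lborel (normal_density 0 (s i))) = PiM I ?N"
    by (rule PiM_cong) (auto simp: s'_def)
  interpret product_sigma_finite ?N
    unfolding product_sigma_finite_def
    using prob_space_normal_density[OF s'] by (auto intro: prob_space_imp_sigma_finite)
  have "(\<integral>\<^sup>+ \<omega>. ennreal (exp (\<Sum>i\<in>I. c i * \<omega> i)) \<partial>PiM I ?N)
      = (\<integral>\<^sup>+ \<omega>. (\<Prod>i\<in>I. ennreal (exp (c i * \<omega> i))) \<partial>PiM I ?N)"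
    by (simp add: exp_sum[OF I] prod_ennreal)
  also have "\<dots> = (\<Prod>i\<in>I. integral\<^sup>N (?N i) (\<lambda>x. ennreal (exp (c i * x))))"
    using I by (rule product_nn_integral_prod) simp
  also have "\<dots> = (\<Prod>i\<in>I. ennreal (exp ((c i)\<^sup>2 * (s' i)\<^sup>2 / 2)))"
    by (simp add: nn_integral_exp_normal s')
  also have "\<dots> = ennreal (exp ((\<Sum>i\<in>I. (c i)\<^sup>2 * (s i)\<^sup>2) / 2))"
    by (simp add: prod_ennreal exp_sum[OF I] sum_divide_distrib s'_def)
  finally show ?thesis by (simp add: eq)
qed

text \<open>Markov's inequality is applied to the sum \<open>F\<close> of all the exponentials,
  whose mean is at most \<open>B\<close>. Where \<open>F\<close> is at most
  \<open>B / \<delta>\<close>, so is each summand, and taking logarithms bounds all forms on the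
  same event.\<close>

lemma gaussian_forms_union_bound:
  assumes I: "finite I" and s: "\<And>i. i \<in> I \<Longrightarrow> s i > 0" and A: "finite A"
    and var: "\<And>a. a \<in> A \<Longrightarrow> (\<Sum>i\<in>I. (c a i)\<^sup>2 * (s i)\<^sup>2) \<le> V"
    and \<delta>: "\<delta> > 0"
  defines "M \<equiv> \<Pi>\<^sub>M i\<in>I. density lborel (normal_density 0 (s i))"
  shows "\<exists>E\<in>sets M. measure M E \<ge> 1 - \<delta> \<and>
    (\<forall>\<omega>\<in>E. \<forall>a\<in>A. (\<Sum>i\<in>I. c a i * \<omega> i) \<le> V / 2 + ln (card A / \<delta>))"
proof -
  interpret prob_space M
    unfolding M_def using s by (intro prob_space_PiM prob_space_normal_density)
  define F where "F \<omega> = (\<Sum>a\<in>A. exp (\<Sum>i\<in>I. c a i * \<omega> i))" for \<omega>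
  define B where "B = card A * exp (V / 2)"
  define E where "E = {\<omega>\<in>space M. F \<omega> \<le> B / \<delta>}"
  have meas1: "(\<lambda>\<omega>. \<Sum>i\<in>I. c a i * \<omega> i) \<in> borel_measurable M" for a
    unfolding M_def by measurable
  then have F: "F \<in> borel_measurable M" unfolding F_def by measurable
  have E: "E \<in> sets M" unfolding E_def using F by measurable
  have "prob (space M - E) \<le> \<delta>" if "A \<noteq> {}"
  proof -
    have B: "B > 0" using A that by (simp add: B_def card_gt_0_iff)
    have "(\<integral>\<^sup>+ \<omega>. ennreal (F \<omega>) \<partial>M) = (\<Sum>a\<in>A. \<integral>\<^sup>+ \<omega>. ennreal (exp (\<Sum>i\<in>I. c a i * \<omega> i)) \<partial>M)"
      unfolding F_def using meas1 by (subst nn_integral_sum[symmetric]) (auto simp: sum_ennreal)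
    also have "\<dots> = (\<Sum>a\<in>A. ennreal (exp ((\<Sum>i\<in>I. (c a i)\<^sup>2 * (s i)\<^sup>2) / 2)))"
      unfolding M_def by (simp add: nn_integral_exp_gaussian_form[OF I s])
    also have "\<dots> \<le> (\<Sum>a\<in>A. ennreal (exp (V / 2)))"
      using var by (intro sum_mono) (simp add: ennreal_leI)
    also have "\<dots> = ennreal B"
      by (simp add: B_def ennreal_mult' ennreal_of_nat_eq_real_of_nat)
    finally have int: "(\<integral>\<^sup>+ \<omega>. ennreal (F \<omega>) \<partial>M) \<le> ennreal B" .
    \<comment> \<open>Outside \<open>E\<close> the normalised sum \<open>\<delta> / B * F\<close>
      exceeds 1, which is the shape in which Markov's inequality is applied.\<close>
    have "space M - E \<subseteq> {\<omega>\<in>space M. 1 \<le> ennreal (\<delta> / B) * ennreal (F \<omega>)}"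
    proof clarify
      fix \<omega> assume "\<omega> \<in> space M" "\<omega> \<notin> E"
      then have "1 \<le> \<delta> / B * F \<omega>" using B \<delta> by (simp add: E_def field_simps)
      then have "ennreal 1 \<le> ennreal (\<delta> / B * F \<omega>)" by (rule ennreal_leI)
      then show "1 \<le> ennreal (\<delta> / B) * ennreal (F \<omega>)" using B \<delta> by (simp flip: ennreal_mult')
    qed
    then have "emeasure M (space M - E) \<le> emeasure M {\<omega>\<in>space M. 1 \<le> ennreal (\<delta> / B) * ennreal (F \<omega>)}"
      using F by (intro emeasure_mono) measurable
    also have "\<dots> \<le> ennreal (\<delta> / B) * (\<integral>\<^sup>+ \<omega>. ennreal (F \<omega>) * indicator (space M) \<omega> \<partial>M)"
      using F by (intro nn_integral_Markov_inequality) auto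
    also have "(\<integral>\<^sup>+ \<omega>. ennreal (F \<omega>) * indicator (space M) \<omega> \<partial>M) = (\<integral>\<^sup>+ \<omega>. ennreal (F \<omega>) \<partial>M)"
      by (intro nn_integral_cong) auto
    also have "ennreal (\<delta> / B) * \<dots> \<le> ennreal (\<delta> / B) * ennreal B"
      by (intro mult_left_mono int) simp
    also have "\<dots> = ennreal \<delta>" using B \<delta> by (simp flip: ennreal_mult')
    finally show ?thesis using \<delta> by (simp add: emeasure_eq_measure)
  qed
  \<comment> \<open>With no forms at all, \<open>F\<close> and \<open>B\<close> are both 0 and
    \<open>E\<close> is the whole space.\<close>
  moreover have "prob (space M - E) \<le> \<delta>" if "A = {}"
    using that \<delta> by (simp add: E_def F_def B_def)
  ultimately have prob: "prob E \<ge> 1 - \<delta>"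
    using prob_compl[OF E] by fastforce
  have "(\<Sum>i\<in>I. c a i * \<omega> i) \<le> V / 2 + ln (card A / \<delta>)" if "\<omega> \<in> E" "a \<in> A" for \<omega> a
  proof -
    have "exp (\<Sum>i\<in>I. c a i * \<omega> i) \<le> F \<omega>"
      unfolding F_def using that A by (intro member_le_sum) auto
    also have "\<dots> \<le> exp (V / 2) * (card A / \<delta>)" using that by (simp add: E_def B_def mult_ac)
    also have "\<dots> = exp (V / 2 + ln (card A / \<delta>))"
    proof -
      have "card A > 0" using that A by (auto simp: card_gt_0_iff)
      then have "card A / \<delta> > 0" using \<delta> by simp
      then show ?thesis by (simp only: exp_add exp_ln)
    qed
    finally show ?thesis by simp
  qed
  then show ?thesis using E prob by blast
qed

section \<open>Perturbed linear networks\<close>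

lemma euclidean_norm_eq_L2_set: "euclidean_norm v = L2_set (($) v) {..<dim_vec v}"
  by (simp add: euclidean_norm_def L2_set_def scalar_prod_def power2_eq_square atLeast0LessThan)

lemma euclidean_norm_nonneg [simp]: "0 \<le> euclidean_norm v"
  by (simp add: euclidean_norm_eq_L2_set)

lemma euclidean_norm_add_le:
  assumes "u \<in> carrier_vec N" "v \<in> carrier_vec N"
  shows "euclidean_norm (u + v) \<le> euclidean_norm u + euclidean_norm v"
proof -
  have "L2_set (($) (u + v)) {..<N} = L2_set (\<lambda>i. u $ i + v $ i) {..<N}"
    using assms by (intro L2_set_cong) auto
  then show ?thesis
    using L2_set_triangle_ineq[of "($) u" "($) v" "{..<N}"] assms
    by (auto simp: euclidean_norm_eq_L2_set)
qed

lemma euclidean_norm_smult: "euclidean_norm (c \<cdot>\<^sub>v v) = \<bar>c\<bar> * euclidean_norm v"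
proof -
  have "L2_set (($) (c \<cdot>\<^sub>v v)) {..<dim_vec v} = L2_set (\<lambda>i. \<bar>c\<bar> * v $ i) {..<dim_vec v}"
    unfolding L2_set_def by (simp add: power_mult_distrib)
  then show ?thesis by (simp add: euclidean_norm_eq_L2_set L2_set_right_distrib)
qed

lemma euclidean_norm_uminus: "euclidean_norm (- v) = euclidean_norm v"
  by (simp add: euclidean_norm_eq_L2_set L2_set_def)

lemma abs_index_le_euclidean_norm:
  assumes "i < dim_vec v"
  shows "\<bar>v $ i\<bar> \<le> euclidean_norm v"
proof -
  have "(v $ i)\<^sup>2 \<le> (\<Sum>i<dim_vec v. (v $ i)\<^sup>2)"
    using assms by (intro member_le_sum) auto
  then show ?thesis
    by (simp add: euclidean_norm_eq_L2_set L2_set_def real_le_rsqrt)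
qed

text \<open>Cauchy-Schwarz in every row. This turns the Frobenius radius of the ball into an
  operator norm bound for the perturbation of each layer.\<close>

lemma euclidean_norm_mult_mat_vec_le:
  assumes "A \<in> carrier_mat p q" "v \<in> carrier_vec q"
  shows "euclidean_norm (A *\<^sub>v v) \<le> frobenius_norm A * euclidean_norm v"
proof -
  have "((A *\<^sub>v v) $ i)\<^sup>2 \<le> (\<Sum>j<q. (A $$ (i, j))\<^sup>2) * (\<Sum>j<q. (v $ j)\<^sup>2)" if "i < p" for i
    using Cauchy_Schwarz_ineq_sum[of "\<lambda>j. A $$ (i, j)" "\<lambda>j. v $ j" "{..<q}"] assms that
    by (simp add: scalar_prod_def atLeast0LessThan)
  then have "(\<Sum>i<p. ((A *\<^sub>v v) $ i)\<^sup>2) \<le> (\<Sum>i<p. (\<Sum>j<q. (A $$ (i, j))\<^sup>2) * (\<Sum>j<q. (v $ j)\<^sup>2))"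
    by (intro sum_mono) auto
  then have "sqrt (\<Sum>i<p. ((A *\<^sub>v v) $ i)\<^sup>2) \<le> sqrt ((\<Sum>i<p. (\<Sum>j<q. (A $$ (i, j))\<^sup>2)) * (\<Sum>j<q. (v $ j)\<^sup>2))"
    by (simp only: sum_distrib_right real_sqrt_le_mono)
  then show ?thesis
    using assms by (simp add: euclidean_norm_eq_L2_set L2_set_def frobenius_norm_def real_sqrt_mult)
qed

lemma param_dist_bounds_layer:
  assumes "param_dist d p q \<le> r" "k \<in> {1..d}"
  shows "frobenius_norm (fst p k - fst q k) \<le> r" "euclidean_norm (snd p k - snd q k) \<le> r"
proof -
  let ?f = "\<lambda>k. (frobenius_norm (fst p k - fst q k))\<^sup>2 + (euclidean_norm (snd p k - snd q k))\<^sup>2"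
  have "?f k \<le> (\<Sum>k=1..d. ?f k)"
    using assms(2) by (intro member_le_sum) auto
  then have "sqrt (?f k) \<le> r"
    using assms(1) unfolding param_dist_def by (meson order_trans real_sqrt_le_mono)
  moreover have "\<bar>frobenius_norm (fst p k - fst q k)\<bar> \<le> sqrt (?f k)" "\<bar>euclidean_norm (snd p k - snd q k)\<bar> \<le> sqrt (?f k)"
    by simp_all
  ultimately show "frobenius_norm (fst p k - fst q k) \<le> r" "euclidean_norm (snd p k - snd q k) \<le> r"
    by linarith+
qed

section \<open>Signed sums propagated through the layers\<close>

definition layer_dim :: "nat \<Rightarrow> nat \<Rightarrow> nat \<Rightarrow> nat \<Rightarrow> nat" where
  "layer_dim n d H k = (if k = 0 then n else fan_out d H k)"

text \<open>The purpose of \<open>layer_dim\<close>: layer \<open>Suc k\<close> maps dimension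
  \<open>layer_dim n d H k\<close> to \<open>layer_dim n d H (Suc k)\<close>, so inductions over the
  layers need no separate treatment of the first and the last one.\<close>

lemma fan_in_Suc: "k < d \<Longrightarrow> fan_in n H (Suc k) = layer_dim n d H k"
  by (auto simp: fan_in_def fan_out_def layer_dim_def)

lemma fan_out_Suc: "fan_out d H (Suc k) = layer_dim n d H (Suc k)"
  by (simp add: layer_dim_def)

lemma param_space_carrier:
  assumes "p \<in> param_space n d H" "k < d"
  shows "fst p (Suc k) \<in> carrier_mat (layer_dim n d H (Suc k)) (layer_dim n d H k)"
    and "snd p (Suc k) \<in> carrier_vec (layer_dim n d H (Suc k))"
proof -
  have "Suc k \<in> {1..d}" using assms(2) by simp
  then show "fst p (Suc k) \<in> carrier_mat (layer_dim n d H (Suc k)) (layer_dim n d H k)"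
    and "snd p (Suc k) \<in> carrier_vec (layer_dim n d H (Suc k))"
    using assms(1) unfolding param_space_def fan_in_Suc[OF assms(2), symmetric] fan_out_Suc[symmetric]
    by (simp_all add: case_prod_beta)
qed

lemma layer_output_carrier:
  assumes "p \<in> param_space n d H" "x \<in> carrier_vec n" "k \<le> d"
  shows "layer_output p x k \<in> carrier_vec (layer_dim n d H k)"
  using assms(3)
proof (induction k)
  case 0
  show ?case using assms(2) by (simp add: layer_dim_def)
next
  case (Suc k)
  then have k: "k < d" and IH: "layer_output p x k \<in> carrier_vec (layer_dim n d H k)" by simp_all
  show ?case
    unfolding layer_output.simps
    by (intro add_carrier_vec mult_mat_vec_carrier[OF _ IH] param_space_carrier[OF assms(1) k])
qed

text \<open>Given entrywise rather than as a sum of vectors, so that the dimension is right for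
  every \<open>m\<close>, including 0.\<close>

definition signed_layer_sum ::
    "nat \<Rightarrow> nat \<Rightarrow> nat \<Rightarrow> params \<Rightarrow> nat \<Rightarrow> (nat \<Rightarrow> real vec) \<Rightarrow> (nat \<Rightarrow> real) \<Rightarrow> nat \<Rightarrow> real vec" where
  "signed_layer_sum n d H p m x \<xi> k =
     vec (layer_dim n d H k) (\<lambda>j. \<Sum>i<m. \<xi> i * layer_output p (x i) k $ j)"

text \<open>The layer maps are affine: the linear part commutes with signed sums, while the bias is
  added once per sample and so collects the sum of the signs.\<close>

lemma signed_layer_sum_Suc:
  assumes p: "p \<in> param_space n d H" and x: "\<And>i. i < m \<Longrightarrow> x i \<in> carrier_vec n" and k: "k < d"
  shows "signed_layer_sum n d H p m x \<xi> (Suc k) =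
    fst p (Suc k) *\<^sub>v signed_layer_sum n d H p m x \<xi> k + (\<Sum>i<m. \<xi> i) \<cdot>\<^sub>v snd p (Suc k)"
proof (rule eq_vecI)
  note W = param_space_carrier[OF p k]
  let ?W = "fst p (Suc k)" and ?b = "snd p (Suc k)"
  let ?p = "layer_dim n d H (Suc k)" and ?q = "layer_dim n d H k"
  have dim: "dim_vec (layer_output p (x i) k) = ?q" if "i < m" for i
    using layer_output_carrier[OF p x[OF that], of k] k by auto
  show "dim_vec (signed_layer_sum n d H p m x \<xi> (Suc k))
      = dim_vec (?W *\<^sub>v signed_layer_sum n d H p m x \<xi> k + (\<Sum>i<m. \<xi> i) \<cdot>\<^sub>v ?b)"
    using W by (simp add: signed_layer_sum_def)
  fix j assume "j < dim_vec (?W *\<^sub>v signed_layer_sum n d H p m x \<xi> k + (\<Sum>i<m. \<xi> i) \<cdot>\<^sub>v ?b)"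
  then have j: "j < ?p" using W by simp
  have "signed_layer_sum n d H p m x \<xi> (Suc k) $ j
      = (\<Sum>i<m. \<xi> i * ((\<Sum>l<?q. ?W $$ (j, l) * layer_output p (x i) k $ l) + ?b $ j))"
    using j W dim by (simp add: signed_layer_sum_def scalar_prod_def atLeast0LessThan)
  also have "\<dots> = (\<Sum>i<m. \<Sum>l<?q. ?W $$ (j, l) * (\<xi> i * layer_output p (x i) k $ l)) + (\<Sum>i<m. \<xi> i) * ?b $ j"
    by (simp add: distrib_left sum.distrib sum_distrib_left sum_distrib_right mult_ac)
  also have "\<dots> = (\<Sum>l<?q. ?W $$ (j, l) * (\<Sum>i<m. \<xi> i * layer_output p (x i) k $ l)) + (\<Sum>i<m. \<xi> i) * ?b $ j"
    by (subst sum.swap) (simp add: sum_distrib_left)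
  also have "\<dots> = (?W *\<^sub>v signed_layer_sum n d H p m x \<xi> k + (\<Sum>i<m. \<xi> i) \<cdot>\<^sub>v ?b) $ j"
    using j W by (simp add: signed_layer_sum_def scalar_prod_def atLeast0LessThan)
  finally show "signed_layer_sum n d H p m x \<xi> (Suc k) $ j
      = (?W *\<^sub>v signed_layer_sum n d H p m x \<xi> k + (\<Sum>i<m. \<xi> i) \<cdot>\<^sub>v ?b) $ j" .
qed

text \<open>Each layer multiplies the accumulated norm by at most \<open>t\<close> and adds one bias
  term. Since \<open>t \<ge> 1\<close>, each of the \<open>k\<close> bias terms can be charged the
  full power \<open>t ^ k\<close>, which gives a closed form for the induction.\<close>

lemma signed_layer_sum_le:
  assumes p: "p \<in> param_space n d H" and x: "\<And>i. i < m \<Longrightarrow> x i \<in> carrier_vec n" and t: "t \<ge> 1"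
    and W: "\<And>k v. k < d \<Longrightarrow> v \<in> carrier_vec (layer_dim n d H k) \<Longrightarrow>
      euclidean_norm (fst p (Suc k) *\<^sub>v v) \<le> t * euclidean_norm v"
    and b: "\<And>k. k < d \<Longrightarrow> euclidean_norm (snd p (Suc k)) \<le> t"
    and k: "k \<le> d"
  shows "euclidean_norm (signed_layer_sum n d H p m x \<xi> k) \<le>
    t ^ k * (L2_set (\<lambda>j. \<Sum>i<m. \<xi> i * x i $ j) {..<n} + k * \<bar>\<Sum>i<m. \<xi> i\<bar>)"
  using k
proof (induction k)
  case 0
  have "L2_set (($) (signed_layer_sum n d H p m x \<xi> 0)) {..<n} = L2_set (\<lambda>j. \<Sum>i<m. \<xi> i * x i $ j) {..<n}"
    by (rule L2_set_cong) (auto simp: signed_layer_sum_def layer_dim_def)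
  then show ?case by (simp add: euclidean_norm_eq_L2_set signed_layer_sum_def layer_dim_def)
next
  case (Suc k)
  let ?U = "signed_layer_sum n d H p m x \<xi>" and ?S = "\<Sum>i<m. \<xi> i"
  let ?X = "L2_set (\<lambda>j. \<Sum>i<m. \<xi> i * x i $ j) {..<n}"
  have k: "k < d" using Suc.prems by simp
  have U: "?U k \<in> carrier_vec (layer_dim n d H k)" by (simp add: signed_layer_sum_def)
  have eq: "?U (Suc k) = fst p (Suc k) *\<^sub>v ?U k + ?S \<cdot>\<^sub>v snd p (Suc k)"
    by (rule signed_layer_sum_Suc[OF p _ k]) (rule x)
  have "euclidean_norm (?U (Suc k)) \<le>
      euclidean_norm (fst p (Suc k) *\<^sub>v ?U k) + euclidean_norm (?S \<cdot>\<^sub>v snd p (Suc k))"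
    unfolding eq using param_space_carrier[OF p k] U by (intro euclidean_norm_add_le) auto
  also have "\<dots> \<le> t * (t ^ k * (?X + k * \<bar>?S\<bar>)) + \<bar>?S\<bar> * t ^ Suc k"
  proof (intro add_mono)
    show "euclidean_norm (fst p (Suc k) *\<^sub>v ?U k) \<le> t * (t ^ k * (?X + k * \<bar>?S\<bar>))"
      by (rule order_trans[OF W[OF k U] mult_left_mono[OF Suc.IH]]) (use k t in auto)
    have "t * 1 \<le> t * t ^ k" using t by (intro mult_left_mono) auto
    then show "euclidean_norm (?S \<cdot>\<^sub>v snd p (Suc k)) \<le> \<bar>?S\<bar> * t ^ Suc k"
      using b[OF k] unfolding euclidean_norm_smult by (intro mult_left_mono) auto
  qed
  also have "\<dots> = t ^ Suc k * (?X + Suc k * \<bar>?S\<bar>)" by (simp add: algebra_simps)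
  finally show ?case .
qed

text \<open>Since the initial biases vanish, biases in the ball have norm at most \<open>r\<close>,
  and weight matrices differ from the initial ones by Frobenius norm at most \<open>r\<close>. The
  single constant \<open>s + r\<close> covers both, and the output is one coordinate of the last
  signed sum.\<close>

lemma sum_sign_net_le:
  fixes \<xi> :: "nat \<Rightarrow> real"
  assumes Z: "(Z, \<lambda>k. 0\<^sub>v (fan_out d H k)) \<in> param_space n d H"
    and op: "\<And>k v. k < d \<Longrightarrow> v \<in> carrier_vec (layer_dim n d H k) \<Longrightarrow>
      euclidean_norm (Z (Suc k) *\<^sub>v v) \<le> s * euclidean_norm v"
    and s: "s \<ge> 1" and r: "r \<ge> 0" and d: "d \<ge> 1"
    and p: "p \<in> param_ball n d H (Z, \<lambda>k. 0\<^sub>v (fan_out d H k)) r"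
    and x: "\<And>i. i < m \<Longrightarrow> x i \<in> carrier_vec n"
  shows "(\<Sum>i<m. \<xi> i * net d p (x i)) \<le>
    (s + r) ^ d * (L2_set (\<lambda>j. \<Sum>i<m. \<xi> i * x i $ j) {..<n} + d * \<bar>\<Sum>i<m. \<xi> i\<bar>)"
proof -
  have ps: "p \<in> param_space n d H"
    and dist: "param_dist d (Z, \<lambda>k. 0\<^sub>v (fan_out d H k)) p \<le> r"
    using p unfolding param_ball_def by simp_all
  have "euclidean_norm (signed_layer_sum n d H p m x \<xi> d) \<le>
    (s + r) ^ d * (L2_set (\<lambda>j. \<Sum>i<m. \<xi> i * x i $ j) {..<n} + d * \<bar>\<Sum>i<m. \<xi> i\<bar>)"
  proof (rule signed_layer_sum_le[where \<xi> = \<xi> and t = "s + r" and x = x and m = m and k = d, OF ps])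
    fix k assume k: "k < d"
    then have k': "Suc k \<in> {1..d}" by auto
    note near = param_dist_bounds_layer[OF dist k', simplified]
    note W = param_space_carrier[OF ps k]
    note ZW = param_space_carrier(1)[OF Z k, simplified]
    have "0\<^sub>v (fan_out d H (Suc k)) - snd p (Suc k) = - snd p (Suc k)"
      using W(2) by (simp add: fan_out_Suc[of d H k n] carrier_vecD)
    then show "euclidean_norm (snd p (Suc k)) \<le> s + r"
      using near(2) s by (simp add: euclidean_norm_uminus)
    fix v :: "real vec" assume v: "v \<in> carrier_vec (layer_dim n d H k)"
    let ?D = "Z (Suc k) - fst p (Suc k)"
    have D: "?D \<in> carrier_mat (layer_dim n d H (Suc k)) (layer_dim n d H k)" using ZW W by auto
    \<comment> \<open>Written as a sum with a negated term to match the triangle inequality for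
      vector sums.\<close>
    have "fst p (Suc k) *\<^sub>v v = Z (Suc k) *\<^sub>v v + - (?D *\<^sub>v v)"
      using ZW W v by (intro eq_vecI) (simp_all add: minus_mult_distrib_mat_vec[OF ZW W(1) v] carrier_vecD carrier_matD)
    also have "euclidean_norm \<dots> \<le> euclidean_norm (Z (Suc k) *\<^sub>v v) + euclidean_norm (- (?D *\<^sub>v v))"
      using ZW D v by (intro euclidean_norm_add_le[where N = "layer_dim n d H (Suc k)"]) auto
    also have "\<dots> \<le> s * euclidean_norm v + frobenius_norm ?D * euclidean_norm v"
      using op[OF k v] euclidean_norm_mult_mat_vec_le[OF D v] by (simp add: euclidean_norm_uminus)
    also have "\<dots> \<le> (s + r) * euclidean_norm v"
      using near(1) by (simp add: distrib_right mult_right_mono)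
    finally show "euclidean_norm (fst p (Suc k) *\<^sub>v v) \<le> (s + r) * euclidean_norm v" .
  qed (use s r x in auto)
  moreover have "(\<Sum>i<m. \<xi> i * net d p (x i)) = signed_layer_sum n d H p m x \<xi> d $ 0"
    using d by (simp add: signed_layer_sum_def layer_dim_def fan_out_def net_def)
  moreover have "\<bar>signed_layer_sum n d H p m x \<xi> d $ 0\<bar> \<le> euclidean_norm (signed_layer_sum n d H p m x \<xi> d)"
    using d by (intro abs_index_le_euclidean_norm) (simp add: signed_layer_sum_def layer_dim_def fan_out_def)
  ultimately show ?thesis by linarith
qed

section \<open>Rademacher averages\<close>

lemma finite_sign_vectors: "finite (sign_vectors m)" and sign_vectors_nonempty: "sign_vectors m \<noteq> {}"
  by (simp_all add: sign_vectors_def PiE_eq_empty_iff finite_PiE)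

text \<open>Orthogonality of the signs: flipping coordinate \<open>i\<close> is an involution of the
  sign vectors that negates the product when \<open>j\<close> differs from \<open>i\<close>.\<close>

lemma sum_sign_vectors_mult:
  assumes "i < m" "j < m"
  shows "(\<Sum>\<xi>\<in>sign_vectors m. \<xi> i * \<xi> j) = (if i = j then real (card (sign_vectors m)) else 0)"
proof (cases "i = j")
  case True
  have "\<xi> i * \<xi> i = 1" if "\<xi> \<in> sign_vectors m" for \<xi>
    using PiE_mem[OF that[unfolded sign_vectors_def], of i] assms by auto
  then show ?thesis using True by simp
next
  case False
  let ?flip = "\<lambda>\<xi>::nat \<Rightarrow> real. \<xi>(i := - \<xi> i)"
  have flip: "?flip \<xi> \<in> sign_vectors m" if "\<xi> \<in> sign_vectors m" for \<xi>
    using that assms(1) by (fastforce simp: sign_vectors_def PiE_iff extensional_def)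
  have "(\<Sum>\<xi>\<in>sign_vectors m. \<xi> i * \<xi> j) = (\<Sum>\<xi>\<in>sign_vectors m. - (\<xi> i * \<xi> j))"
    by (rule sum.reindex_bij_witness[where i = ?flip and j = ?flip]) (use flip False in auto)
  then show ?thesis using False by (simp add: sum_negf)
qed

text \<open>Jensen's inequality as Cauchy-Schwarz against the constant 1: the mean norm is at most
  the root of the mean square, where the mixed terms cancel by orthogonality.\<close>

lemma sum_sign_vectors_L2_set_le:
  assumes "finite J"
  shows "(\<Sum>\<xi>\<in>sign_vectors m. L2_set (\<lambda>l. \<Sum>i<m. \<xi> i * z i l) J)
    \<le> card (sign_vectors m) * sqrt (\<Sum>i<m. (L2_set (z i) J)\<^sup>2)"
proof -
  let ?S = "sign_vectors m"
  let ?L = "\<lambda>\<xi>. L2_set (\<lambda>l. \<Sum>i<m. \<xi> i * z i l) J"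
  have sq: "(\<Sum>\<xi>\<in>?S. (\<Sum>i<m. \<xi> i * z i l)\<^sup>2) = card ?S * (\<Sum>i<m. (z i l)\<^sup>2)" for l
  proof -
    have "(\<Sum>\<xi>\<in>?S. (\<Sum>i<m. \<xi> i * z i l)\<^sup>2) = (\<Sum>\<xi>\<in>?S. \<Sum>i<m. \<Sum>j<m. z i l * z j l * (\<xi> i * \<xi> j))"
      by (simp add: power2_eq_square sum_product mult_ac)
    also have "\<dots> = (\<Sum>i<m. \<Sum>j<m. z i l * z j l * (\<Sum>\<xi>\<in>?S. \<xi> i * \<xi> j))"
      by (subst sum.swap, intro sum.cong refl, subst sum.swap) (simp add: sum_distrib_left)
    also have "\<dots> = (\<Sum>i<m. \<Sum>j<m. if j = i then card ?S * (z i l)\<^sup>2 else 0)"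
      by (intro sum.cong refl) (auto simp: sum_sign_vectors_mult power2_eq_square)
    finally show ?thesis by (simp add: sum_distrib_left)
  qed
  have "(\<Sum>\<xi>\<in>?S. 1 * ?L \<xi>)\<^sup>2 \<le> (\<Sum>\<xi>\<in>?S. 1\<^sup>2) * (\<Sum>\<xi>\<in>?S. (?L \<xi>)\<^sup>2)"
    by (rule Cauchy_Schwarz_ineq_sum)
  also have "(\<Sum>\<xi>\<in>?S. (?L \<xi>)\<^sup>2) = (\<Sum>\<xi>\<in>?S. \<Sum>l\<in>J. (\<Sum>i<m. \<xi> i * z i l)\<^sup>2)"
    by (simp add: L2_set_def sum_nonneg)
  also have "\<dots> = (\<Sum>l\<in>J. card ?S * (\<Sum>i<m. (z i l)\<^sup>2))"
    by (subst sum.swap) (simp add: sq)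
  also have "\<dots> = card ?S * (\<Sum>i<m. (L2_set (z i) J)\<^sup>2)"
    by (simp add: L2_set_def sum_nonneg sum_distrib_left) (rule sum.swap)
  also have "(\<Sum>\<xi>\<in>?S. 1\<^sup>2) * \<dots> = (card ?S * sqrt (\<Sum>i<m. (L2_set (z i) J)\<^sup>2))\<^sup>2"
    by (simp add: power_mult_distrib sum_nonneg power2_eq_square)
  finally have "(\<Sum>\<xi>\<in>?S. ?L \<xi>)\<^sup>2 \<le> (card ?S * sqrt (\<Sum>i<m. (L2_set (z i) J)\<^sup>2))\<^sup>2" by simp
  then show ?thesis by (rule power2_le_imp_le) (simp add: sum_nonneg)
qed

text \<open>The bound of \<open>sum_sign_net_le\<close> is uniform over the ball, hence bounds the
  supremum. Averaged over the signs, both of its terms are of order \<open>sqrt m\<close>, and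
  division by \<open>m\<close> leaves \<open>1 / sqrt m\<close>. The scale \<open>max 1 ...\<close>
  absorbs the bias term, which carries no input norm.\<close>

lemma rademacher_complexity_ball_le:
  assumes Z: "(Z, \<lambda>k. 0\<^sub>v (fan_out d H k)) \<in> param_space n d H"
    and op: "\<And>k v. k < d \<Longrightarrow> v \<in> carrier_vec (layer_dim n d H k) \<Longrightarrow>
      euclidean_norm (Z (Suc k) *\<^sub>v v) \<le> s * euclidean_norm v"
    and s: "s \<ge> 1" and r: "r \<ge> 0" and d: "d \<ge> 1" and m: "m \<ge> 1"
    and x: "\<And>i. i < m \<Longrightarrow> x i \<in> carrier_vec n"
  shows "rademacher_complexity d (param_ball n d H (Z, \<lambda>k. 0\<^sub>v (fan_out d H k)) r) m x \<le>
    2 * (real d * s ^ d * (r + 1) ^ d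
      * max 1 (Max ((\<lambda>i. euclidean_norm (x i)) ` {..<m})) / sqrt (real m))"
proof -
  let ?P = "param_ball n d H (Z, \<lambda>k. 0\<^sub>v (fan_out d H k)) r"
  let ?S = "sign_vectors m"
  let ?X = "\<lambda>\<xi>. L2_set (\<lambda>j. \<Sum>i<m. \<xi> i * x i $ j) {..<n}"
  define R where "R = max 1 (Max ((\<lambda>i. euclidean_norm (x i)) ` {..<m}))"
  have R: "euclidean_norm (x i) \<le> R" if "i < m" for i
    unfolding R_def using that by (intro max.coboundedI2 Max_ge) auto
  have R1: "R \<ge> 1" by (simp add: R_def)
  have dim: "dim_vec (x i) = n" if "i < m" for i using x[OF that] by auto
  have c: "real (card ?S) > 0"
    using finite_sign_vectors sign_vectors_nonempty by (simp add: card_gt_0_iff)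
  \<comment> \<open>The centre has distance 0 from itself; the ball is therefore nonempty, as the
    supremum rule below requires.\<close>
  have "(\<Sum>k=1..d. (frobenius_norm (Z k - Z k))\<^sup>2 + (euclidean_norm (0\<^sub>v (fan_out d H k) - 0\<^sub>v (fan_out d H k)))\<^sup>2) = 0"
    by (intro sum.neutral) (auto simp: frobenius_norm_def euclidean_norm_eq_L2_set L2_set_def)
  then have "(Z, \<lambda>k. 0\<^sub>v (fan_out d H k)) \<in> ?P"
    using Z r by (simp add: param_ball_def param_dist_def)
  then have "?P \<noteq> {}" by blast
  then have sup: "(SUP p\<in>?P. \<Sum>i<m. \<xi> i * net d p (x i)) \<le> (s + r) ^ d * (?X \<xi> + d * \<bar>\<Sum>i<m. \<xi> i\<bar>)"
    for \<xi> :: "nat \<Rightarrow> real"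
    by (rule cSUP_least) (rule sum_sign_net_le[OF Z _ s r d], use op x in auto)
  have "(\<Sum>i<m. (L2_set (($) (x i)) {..<n})\<^sup>2) \<le> (\<Sum>i<m. R\<^sup>2)"
    using R dim by (intro sum_mono power_mono) (auto simp: euclidean_norm_eq_L2_set)
  then have "sqrt (\<Sum>i<m. (L2_set (($) (x i)) {..<n})\<^sup>2) \<le> sqrt (m * R\<^sup>2)" by simp
  then have EX: "(\<Sum>\<xi>\<in>?S. ?X \<xi>) \<le> card ?S * (sqrt m * R)"
    using R1 by (intro order_trans[OF sum_sign_vectors_L2_set_le]) (auto simp: real_sqrt_mult intro!: mult_left_mono)
  \<comment> \<open>Over a one-point index set \<open>L2_set\<close> is an absolute value, so the
    same second-moment estimate covers the sum of the signs.\<close>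
  have "(\<Sum>\<xi>\<in>?S. \<bar>\<Sum>i<m. \<xi> i\<bar>) \<le> card ?S * sqrt m"
    using sum_sign_vectors_L2_set_le[where J = "{()}" and m = m and z = "\<lambda>_ _. 1"] by simp
  also have "\<dots> \<le> card ?S * (sqrt m * R)" using mult_left_mono[OF R1, of "sqrt m"] by (intro mult_left_mono) auto
  finally have ES: "(\<Sum>\<xi>\<in>?S. \<bar>\<Sum>i<m. \<xi> i\<bar>) \<le> card ?S * (sqrt m * R)" .
  have "(\<Sum>\<xi>\<in>?S. SUP p\<in>?P. \<Sum>i<m. \<xi> i * net d p (x i))
      \<le> (\<Sum>\<xi>\<in>?S. (s + r) ^ d * (?X \<xi> + d * \<bar>\<Sum>i<m. \<xi> i\<bar>))"
    by (intro sum_mono sup)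
  also have "\<dots> = (s + r) ^ d * ((\<Sum>\<xi>\<in>?S. ?X \<xi>) + d * (\<Sum>\<xi>\<in>?S. \<bar>\<Sum>i<m. \<xi> i\<bar>))"
    by (simp add: sum_distrib_left sum.distrib distrib_left)
  also have "\<dots> \<le> (s * (r + 1)) ^ d * (card ?S * (sqrt m * R) + d * (card ?S * (sqrt m * R)))"
  proof (rule mult_mono)
    \<comment> \<open>This separates the factor \<open>s ^ d\<close>, which becomes
      \<open>c ^ d\<close>, from \<open>(r + 1) ^ d\<close>.\<close>
    have "s + r \<le> s * (r + 1)"
      using s r mult_right_mono[of 1 s r] by (simp add: distrib_left)
    then show "(s + r) ^ d \<le> (s * (r + 1)) ^ d" using s r by (intro power_mono) auto
    show "(\<Sum>\<xi>\<in>?S. ?X \<xi>) + d * (\<Sum>\<xi>\<in>?S. \<bar>\<Sum>i<m. \<xi> i\<bar>)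
        \<le> card ?S * (sqrt m * R) + d * (card ?S * (sqrt m * R))"
      by (intro add_mono mult_left_mono EX ES) simp
  qed (use s r in \<open>auto intro!: add_nonneg_nonneg mult_nonneg_nonneg sum_nonneg\<close>)
  also have "\<dots> = (1 + real d) * (card ?S * (sqrt m * R) * (s * (r + 1)) ^ d)"
    by (simp add: algebra_simps)
  \<comment> \<open>The constant 2 of the final bound comes from
    \<open>1 + d \<le> 2 * d\<close>.\<close>
  also have "\<dots> \<le> (2 * real d) * (card ?S * (sqrt m * R) * (s * (r + 1)) ^ d)"
    using d R1 s r by (intro mult_right_mono) auto
  finally have "(\<Sum>\<xi>\<in>?S. SUP p\<in>?P. \<Sum>i<m. \<xi> i * net d p (x i)) / card ?S
      \<le> 2 * real d * (sqrt m * R) * (s * (r + 1)) ^ d"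
    using c by (simp add: field_simps)
  then have "rademacher_complexity d ?P m x \<le> (1 / real m) * (2 * real d * (sqrt m * R) * (s * (r + 1)) ^ d)"
    unfolding rademacher_complexity_def
      integral_pmf_of_set[OF sign_vectors_nonempty finite_sign_vectors]
    by (intro mult_left_mono) auto
  also have "\<dots> = 2 * (real d * s ^ d * (r + 1) ^ d * R / (m / sqrt m))"
    unfolding power_mult_distrib using m by (simp add: field_simps)
  also have "m / sqrt m = sqrt m" by (rule real_div_sqrt) simp
  finally show ?thesis by (simp add: R_def)
qed

section \<open>Weight matrices of the Xavier initialization\<close>

lemma weight_index_eq_Sigma:
  "weight_index n d H = (SIGMA k:{1..d}. {..<fan_out d H k} \<times> {..<fan_in n H k})"
  by (auto simp: weight_index_def)

lemma sum_weight_index: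
  "(\<Sum>w\<in>weight_index n d H. g w) =
    (\<Sum>k=1..d. \<Sum>i<fan_out d H k. \<Sum>j<fan_in n H k. g (k, i, j))"
  by (simp add: weight_index_eq_Sigma sum.Sigma sum.cartesian_product split_def)

lemma xavier_measure_eq:
  "xavier_measure n d H \<sigma> =
    (\<Pi>\<^sub>M w\<in>weight_index n d H. density lborel (normal_density 0 (\<sigma> (fst w))))"
  unfolding xavier_measure_def by (rule PiM_cong) auto

text \<open>One index set for all layers, so that a single union bound treats them together and the
  depth enters only through the logarithm of the cardinality.\<close>

definition ternary_pairs ::
    "nat \<Rightarrow> nat \<Rightarrow> nat \<Rightarrow> (nat \<times> (nat \<Rightarrow> real) \<times> (nat \<Rightarrow> real)) set" where
  "ternary_pairs n d H = (SIGMA k:{1..d}.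
     ({..<fan_out d H k} \<rightarrow>\<^sub>E {-1, 0, 1}) \<times> ({..<fan_in n H k} \<rightarrow>\<^sub>E {-1, 0, 1}))"

lemma finite_ternary_pairs: "finite (ternary_pairs n d H)"
  unfolding ternary_pairs_def by (intro finite_SigmaI finite_cartesian_product finite_PiE) auto

lemma fan_le:
  assumes "n \<ge> 1" "H \<ge> 1"
  shows "fan_out d H k \<le> n * H" "fan_in n H k \<le> n * H"
  using assms by (auto simp: fan_out_def fan_in_def)

lemma card_ternary_pairs_le:
  assumes "n \<ge> 1" "H \<ge> 1"
  shows "card (ternary_pairs n d H) \<le> d * 9 ^ (n * H)"
proof -
  have c: "card ({..<N} \<rightarrow>\<^sub>E {-1, 0, 1 :: real}) = 3 ^ N" for N :: nat
    by (simp add: card_PiE numeral_3_eq_3)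
  have "card (ternary_pairs n d H) = (\<Sum>k=1..d. 3 ^ fan_out d H k * 3 ^ fan_in n H k)"
    unfolding ternary_pairs_def
    by (subst card_SigmaI) (auto simp: card_cartesian_product c intro!: finite_PiE)
  also have "\<dots> \<le> (\<Sum>k=1..d. 3 ^ (n * H) * 3 ^ (n * H))"
    using fan_le[OF assms] by (intro sum_mono mult_mono power_increasing) auto
  also have "\<dots> = d * 9 ^ (n * H)"
    by (simp flip: power_mult_distrib)
  finally show ?thesis .
qed

text \<open>The normalisation by H makes the exponent in the union bound of the same order H as the
  logarithm of the number of test pairs.\<close>

definition ternary_form ::
    "nat \<Rightarrow> nat \<Rightarrow> nat \<Rightarrow> nat \<times> (nat \<Rightarrow> real) \<times> (nat \<Rightarrow> real) \<Rightarrow> nat \<times> nat \<times> nat \<Rightarrow> real" where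
  "ternary_form n d H = (\<lambda>(k, u, v) (k', i, j). if k' = k
     then real H * (u i * v j) / (L2_set u {..<fan_out d H k} * L2_set v {..<fan_in n H k}) else 0)"

text \<open>The squared coefficients sum to at most \<open>H^2\<close>, and each variance is at most
  \<open>a^2 / H\<close>.\<close>

lemma ternary_form_variance_le:
  assumes H: "H \<ge> 1" and \<sigma>: "\<And>k. k \<in> {1..d} \<Longrightarrow> 0 < \<sigma> k \<and> \<sigma> k \<le> a / sqrt (real H)"
    and t: "t \<in> ternary_pairs n d H"
  shows "(\<Sum>w\<in>weight_index n d H. (ternary_form n d H t w)\<^sup>2 * (\<sigma> (fst w))\<^sup>2) \<le> real H * a\<^sup>2"
proof -
  obtain k u v where tk: "t = (k, u, v)" and k: "k \<in> {1..d}"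
    using t by (auto simp: ternary_pairs_def)
  let ?p = "fan_out d H k" and ?q = "fan_in n H k"
  let ?c = "real H / (L2_set u {..<?p} * L2_set v {..<?q})"
  have "(\<Sum>w\<in>weight_index n d H. (ternary_form n d H t w)\<^sup>2 * (\<sigma> (fst w))\<^sup>2)
      = (\<Sum>k'=1..d. if k' = k then \<Sum>i<?p. \<Sum>j<?q. (?c * (u i * v j))\<^sup>2 * (\<sigma> k)\<^sup>2 else 0)"
    unfolding sum_weight_index tk ternary_form_def by (intro sum.cong refl) auto
  also have "\<dots> = (\<Sum>i<?p. \<Sum>j<?q. (?c * (u i * v j))\<^sup>2 * (\<sigma> k)\<^sup>2)"
    using k by simp
  also have "\<dots> = (\<Sum>i<?p. \<Sum>j<?q. ?c\<^sup>2 * (\<sigma> k)\<^sup>2 * ((u i)\<^sup>2 * (v j)\<^sup>2))"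
    by (intro sum.cong refl) (simp only: power_mult_distrib mult_ac)
  also have "\<dots> = ?c\<^sup>2 * (\<sigma> k)\<^sup>2 * ((\<Sum>i<?p. (u i)\<^sup>2) * (\<Sum>j<?q. (v j)\<^sup>2))"
    by (simp only: sum_product sum_distrib_left[symmetric])
  also have "(\<Sum>i<?p. (u i)\<^sup>2) * (\<Sum>j<?q. (v j)\<^sup>2) = (L2_set u {..<?p} * L2_set v {..<?q})\<^sup>2"
    by (simp add: L2_set_def power_mult_distrib sum_nonneg)
  \<comment> \<open>If a test vector is zero, both the quotient and the left side are 0; otherwise
    the norms cancel.\<close>
  also have "?c\<^sup>2 * (\<sigma> k)\<^sup>2 * (L2_set u {..<?p} * L2_set v {..<?q})\<^sup>2 \<le> (real H)\<^sup>2 * (\<sigma> k)\<^sup>2"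
    by (cases "L2_set u {..<?p} * L2_set v {..<?q} = 0") (auto simp: power_divide)
  also have "\<dots> \<le> (real H)\<^sup>2 * (a / sqrt (real H))\<^sup>2"
    using \<sigma>[OF k] by (intro mult_left_mono power_mono) auto
  also have "\<dots> = real H * a\<^sup>2"
    using H by (simp add: power_divide power2_eq_square)
  finally show ?thesis .
qed

lemma sum_ternary_form:
  assumes "k \<in> {1..d}"
  shows "(\<Sum>w\<in>weight_index n d H. ternary_form n d H (k, u, v) w * \<omega> w) =
    real H * (\<Sum>i<fan_out d H k. \<Sum>j<fan_in n H k. u i * \<omega> (k, i, j) * v j)
      / (L2_set u {..<fan_out d H k} * L2_set v {..<fan_in n H k})"
proof -
  let ?p = "fan_out d H k" and ?q = "fan_in n H k"
  let ?N = "L2_set u {..<?p} * L2_set v {..<?q}"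
  have "(\<Sum>w\<in>weight_index n d H. ternary_form n d H (k, u, v) w * \<omega> w)
      = (\<Sum>k'=1..d. if k' = k then \<Sum>i<?p. \<Sum>j<?q. real H * (u i * v j) / ?N * \<omega> (k, i, j) else 0)"
    unfolding sum_weight_index ternary_form_def by (intro sum.cong refl) auto
  also have "\<dots> = (\<Sum>i<?p. \<Sum>j<?q. real H * (u i * v j) / ?N * \<omega> (k, i, j))"
    using assms by simp
  finally show ?thesis by (simp add: sum_distrib_left sum_divide_distrib mult_ac)
qed

text \<open>Bounds the union-bound exponent divided by \<open>H\<close>: half the variance bound,
  the logarithm of the number of ternary pairs, and the confidence term. The number 9 counts the
  pairs of ternary digits.\<close>

definition test_bound :: "nat \<Rightarrow> real \<Rightarrow> nat \<Rightarrow> real \<Rightarrow> real" where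
  "test_bound n a d \<delta> = a\<^sup>2 / 2 + real n * ln 9 + ln (real d) + ln (1 / \<delta>)"

lemma test_bound_nonneg:
  assumes "d \<ge> 1" "\<delta> \<in> {0<..<1}"
  shows "test_bound n a d \<delta> \<ge> 0"
  using assms unfolding test_bound_def by (intro add_nonneg_nonneg ln_ge_zero) auto

lemma ln_width_nonneg:
  assumes "n \<ge> 1" "H \<ge> 1"
  shows "0 \<le> ln (real (n * H))"
proof -
  have "1 \<le> n * H" using assms by (simp add: Suc_le_eq)
  then have "1 \<le> real (n * H)" by linarith
  then show ?thesis by (rule ln_ge_zero)
qed

text \<open>The leading 1 provides the condition \<open>s \<ge> 1\<close> of the deterministic
  estimate and also the lower bound in the soft Theta statement.\<close>

lemma operator_bound_ge_1:
  assumes "n \<ge> 1" "H \<ge> 1" "d \<ge> 1" "\<delta> \<in> {0<..<1}"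
  shows "1 + test_bound n a d \<delta> * (1 + ln (real (n * H))) \<ge> 1"
proof -
  have "0 \<le> test_bound n a d \<delta> * (1 + ln (real (n * H)))"
    using test_bound_nonneg[OF assms(3,4)] ln_width_nonneg[OF assms(1,2)]
    by (intro mult_nonneg_nonneg add_nonneg_nonneg) auto
  then show ?thesis by linarith
qed

text \<open>On the union-bound event, \<open>H\<close> times each normalised ternary bilinear form
  is at most \<open>H * test_bound n a d \<delta>\<close>. Cancelling \<open>H\<close> leaves the
  hypothesis of \<open>L2_set_matrix_vector_le\<close>, with \<open>n * H\<close> as common bound on
  both dimensions.\<close>

lemma xavier_operator_norm_bound:
  assumes n: "n \<ge> 1" and H: "H \<ge> 1" and d: "d \<ge> 1" and \<delta>: "\<delta> \<in> {0<..<1}"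
    and \<sigma>: "\<And>k. k \<in> {1..d} \<Longrightarrow> 0 < \<sigma> k \<and> \<sigma> k \<le> a / sqrt (real H)"
  shows "\<exists>E\<in>sets (xavier_measure n d H \<sigma>). measure (xavier_measure n d H \<sigma>) E \<ge> 1 - \<delta> \<and>
    (\<forall>\<omega>\<in>E. \<forall>k<d. \<forall>y\<in>carrier_vec (layer_dim n d H k).
      euclidean_norm (fst (xavier_params n d H \<omega>) (Suc k) *\<^sub>v y)
        \<le> test_bound n a d \<delta> * (1 + ln (real (n * H))) * euclidean_norm y)"
proof -
  let ?M = "xavier_measure n d H \<sigma>" and ?G = "test_bound n a d \<delta>"
  have fin: "finite (weight_index n d H)" by (simp add: weight_index_eq_Sigma)
  have pos: "\<sigma> (fst w) > 0" if "w \<in> weight_index n d H" for w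
    using that \<sigma> by (auto simp: weight_index_def)
  have variance: "(\<Sum>w\<in>weight_index n d H. (ternary_form n d H t w)\<^sup>2 * (\<sigma> (fst w))\<^sup>2) \<le> real H * a\<^sup>2"
    if "t \<in> ternary_pairs n d H" for t
    by (rule ternary_form_variance_le[OF H _ that]) (rule \<sigma>)
  have "\<exists>E\<in>sets ?M. measure ?M E \<ge> 1 - \<delta> \<and> (\<forall>\<omega>\<in>E. \<forall>t\<in>ternary_pairs n d H.
      (\<Sum>w\<in>weight_index n d H. ternary_form n d H t w * \<omega> w)
        \<le> real H * a\<^sup>2 / 2 + ln (card (ternary_pairs n d H) / \<delta>))"
    unfolding xavier_measure_eq
    by (rule gaussian_forms_union_bound[OF fin _ finite_ternary_pairs],
        erule pos, erule variance, use \<delta> in simp)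
  then obtain E where E1: "E \<in> sets ?M"
    and conj: "measure ?M E \<ge> 1 - \<delta> \<and> (\<forall>\<omega>\<in>E. \<forall>t\<in>ternary_pairs n d H.
      (\<Sum>w\<in>weight_index n d H. ternary_form n d H t w * \<omega> w)
        \<le> real H * a\<^sup>2 / 2 + ln (card (ternary_pairs n d H) / \<delta>))"
    by (rule bexE) (rule that)
  note E2 = conj[THEN conjunct1] and forms = conj[THEN conjunct2, THEN bspec, THEN bspec]
  have exponent: "real H * a\<^sup>2 / 2 + ln (card (ternary_pairs n d H) / \<delta>) \<le> real H * ?G"
    if "t \<in> ternary_pairs n d H" for t
  proof -
    have "card (ternary_pairs n d H) > 0"
      using that finite_ternary_pairs by (auto simp: card_gt_0_iff)
    moreover have "real (card (ternary_pairs n d H)) \<le> real d * 9 ^ (n * H)"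
      using of_nat_mono[OF card_ternary_pairs_le[OF n H, of d], where 'a = real] by simp
    ultimately have "ln (card (ternary_pairs n d H) / \<delta>) \<le> ln (real d * 9 ^ (n * H) * (1 / \<delta>))"
      using \<delta> d by (subst ln_le_cancel_iff) (auto simp: divide_right_mono)
    also have "\<dots> = ln (real d * 9 ^ (n * H)) + ln (1 / \<delta>)"
      using \<delta> d by (intro ln_mult_pos) auto
    also have "ln (real d * 9 ^ (n * H)) = ln (real d) + real (n * H) * ln 9"
      using d by (simp add: ln_mult_pos ln_realpow)
    finally have "ln (card (ternary_pairs n d H) / \<delta>) \<le> (ln (real d) + ln (1 / \<delta>)) + real H * (real n * ln 9)"
      by (simp add: mult_ac)
    \<comment> \<open>These two logarithms do not scale with \<open>H\<close>; being nonnegative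
      they may be multiplied by it, so that \<open>H\<close> factors out of the whole
      exponent.\<close>
    moreover have "1 * (ln (real d) + ln (1 / \<delta>)) \<le> real H * (ln (real d) + ln (1 / \<delta>))"
      using H d \<delta> by (intro mult_right_mono add_nonneg_nonneg ln_ge_zero) auto
    ultimately show ?thesis by (simp add: test_bound_def algebra_simps)
  qed
  have "euclidean_norm (fst (xavier_params n d H \<omega>) (Suc k) *\<^sub>v y)
      \<le> ?G * (1 + ln (real (n * H))) * euclidean_norm y"
    if \<omega>: "\<omega> \<in> E" and k: "k < d" and y: "y \<in> carrier_vec (layer_dim n d H k)" for \<omega> k y
  proof -
    let ?p = "fan_out d H (Suc k)" and ?q = "fan_in n H (Suc k)"
    have dim: "dim_vec y = ?q" using y k by (simp add: fan_in_Suc)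
    have "L2_set (\<lambda>i. \<Sum>j<?q. \<omega> (Suc k, i, j) * y $ j) {..<?p}
        \<le> ?G * (1 + ln (real (n * H))) * L2_set (($) y) {..<?q}"
    proof (rule L2_set_matrix_vector_le)
      fix u v :: "nat \<Rightarrow> real"
      assume "u \<in> {..<?p} \<rightarrow>\<^sub>E {-1, 0, 1}" "v \<in> {..<?q} \<rightarrow>\<^sub>E {-1, 0, 1}"
      then have t: "(Suc k, u, v) \<in> ternary_pairs n d H"
        using k by (simp add: ternary_pairs_def)
      let ?B = "\<Sum>i<?p. \<Sum>j<?q. u i * \<omega> (Suc k, i, j) * v j"
      let ?N = "L2_set u {..<?p} * L2_set v {..<?q}"
      have le: "real H * ?B / ?N \<le> real H * ?G"
        using order_trans[OF forms[OF \<omega> t] exponent[OF t]] k by (simp add: sum_ternary_form)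
      show "?B \<le> ?G * L2_set u {..<?p} * L2_set v {..<?q}"
      \<comment> \<open>If the product of norms is 0 the quotient carries no information, but one
        test vector is then zero and the bilinear form vanishes.\<close>
      proof (cases "?N = 0")
        case True
        then have "(\<forall>i<?p. u i = 0) \<or> (\<forall>j<?q. v j = 0)" by (auto simp: L2_set_eq_0_iff)
        then have "?B = 0" by (auto intro!: sum.neutral)
        then show ?thesis using True by (auto simp: mult.assoc)
      next
        case False
        then have "?N > 0" by (simp add: less_le)
        then show ?thesis using le H by (simp add: field_simps)
      qed
    qed (use n H d \<delta> fan_le[OF n H] test_bound_nonneg in auto)
    moreover have "L2_set (($) (fst (xavier_params n d H \<omega>) (Suc k) *\<^sub>v y)) {..<?p}
        = L2_set (\<lambda>i. \<Sum>j<?q. \<omega> (Suc k, i, j) * y $ j) {..<?p}"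
      using dim by (intro L2_set_cong) (auto simp: xavier_params_def scalar_prod_def atLeast0LessThan)
    ultimately show ?thesis
      by (simp add: euclidean_norm_eq_L2_set dim) (simp add: xavier_params_def)
  qed
  then show ?thesis
    by (intro bexI[OF _ E1] conjI E2 ballI allI impI)
qed

lemma xavier_params_in_param_space: "xavier_params n d H \<omega> \<in> param_space n d H"
  by (auto simp: xavier_params_def param_space_def)

section \<open>Polylogarithmic size of the operator bound, and conclusion\<close>

lemma log_factor_summands_nonneg:
  fixes \<delta> :: real
  assumes "H \<ge> 1" "d > 2" "m \<ge> 1" "\<delta> \<in> {0<..<1}"
  shows "0 \<le> ln (real H)" "0 \<le> ln (real d)" "0 \<le> ln (real m)" "0 \<le> ln (1 / \<delta>)"
proof -
  have "1 \<le> real H" "1 \<le> real d" "1 \<le> real m" "1 \<le> 1 / \<delta>"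
    using assms by auto
  then show "0 \<le> ln (real H)" "0 \<le> ln (real d)" "0 \<le> ln (real m)" "0 \<le> ln (1 / \<delta>)"
    by (simp_all only: ln_ge_zero)
qed

text \<open>For fixed \<open>n\<close> and \<open>a\<close>, \<open>test_bound\<close> and the width
  logarithm are each at most a constant times \<open>log_factor\<close>, whence the exponent 2. The
  lower bound holds with constant 1 and exponent 0.\<close>

lemma soft_Theta_one_operator_norm_bound:
  assumes n: "n \<ge> 1"
  shows "soft_Theta_one (\<lambda>H d m \<delta>. 1 + test_bound n a d \<delta> * (1 + ln (real (n * H))))"
proof -
  let ?c = "\<lambda>H d (m::nat) \<delta>. 1 + test_bound n a d \<delta> * (1 + ln (real (n * H)))"
  let ?K1 = "a\<^sup>2 / 2 + real n * ln 9 + 1" and ?K2 = "1 + ln (real n)"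
  have ge1: "?c H d m \<delta> \<ge> 1" if "H \<ge> 1" "d > 2" "\<delta> \<in> {0<..<1}" for H d m \<delta>
    using that n by (intro operator_bound_ge_1) auto
  have upper: "\<bar>?c H d m \<delta>\<bar> \<le> (1 + ?K1 * ?K2) * log_factor H d m \<delta> ^ 2"
    if *: "H \<ge> 1" "d > 2" "m \<ge> 1" "\<delta> \<in> {0<..<1}" for H d m \<delta>
  proof -
    define L where "L = log_factor H d m \<delta>"
    note nonneg = log_factor_summands_nonneg[OF *]
    have L: "L \<ge> 1" using nonneg by (simp add: L_def log_factor_def)
    have n0: "0 \<le> ln (real n)" using n by simp
    have "(a\<^sup>2 / 2 + real n * ln 9) * 1 \<le> (a\<^sup>2 / 2 + real n * ln 9) * L"
      using L by (intro mult_left_mono) auto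
    moreover have "ln (real d) + ln (1 / \<delta>) \<le> L" using nonneg by (simp add: L_def log_factor_def)
    ultimately have 1: "test_bound n a d \<delta> \<le> ?K1 * L"
      by (simp add: test_bound_def distrib_right)
    have "ln (real (n * H)) = ln (real n) + ln (real H)"
      using n * by (simp add: ln_mult_pos)
    moreover have "1 + ln (real H) \<le> L" using nonneg by (simp add: L_def log_factor_def)
    moreover have "ln (real n) * 1 \<le> ln (real n) * L" using L n0 by (intro mult_left_mono)
    ultimately have 2: "1 + ln (real (n * H)) \<le> ?K2 * L" by (simp add: distrib_right)
    have "test_bound n a d \<delta> * (1 + ln (real (n * H))) \<le> (?K1 * L) * (?K2 * L)"
    proof (rule mult_mono[OF 1 2])
      show "0 \<le> ?K1 * L" using L by (intro mult_nonneg_nonneg add_nonneg_nonneg) auto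
      show "0 \<le> 1 + ln (real (n * H))" using ln_width_nonneg[OF n *(1)] by linarith
    qed
    moreover have "1 \<le> L ^ 2" using L by simp
    ultimately have "?c H d m \<delta> \<le> (1 + ?K1 * ?K2) * L ^ 2"
      by (simp add: power2_eq_square algebra_simps)
    then show ?thesis using ge1[of H d \<delta>] * by (simp add: L_def)
  qed
  have "soft_O_one ?c"
    unfolding soft_O_one_def
    by (intro exI[of _ "1 + ?K1 * ?K2"] exI[of _ 2] allI impI ballI) (rule upper)
  moreover have "\<forall>H\<ge>1. \<forall>d>2. \<forall>m\<ge>1. \<forall>\<delta>\<in>{0<..<1}. 1 / log_factor H d m \<delta> ^ 0 \<le> ?c H d m \<delta>"
    unfolding power_0 div_by_1 by (intro allI impI ballI) (rule ge1)
  then have "\<exists>K>0. \<exists>p. \<forall>H\<ge>1. \<forall>d>2. \<forall>m\<ge>1. \<forall>\<delta>\<in>{0<..<1}. K / log_factor H d m \<delta> ^ p \<le> ?c H d m \<delta>"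
    by (intro exI[of _ "1::real"] exI[of _ "0::nat"] conjI, simp)
  ultimately show ?thesis unfolding soft_Theta_one_def by (rule conjI)
qed

text \<open>All randomness is spent on one event, where every initial operator norm is at most
  \<open>c - 1\<close>. What follows on it is deterministic, so \<open>r\<close>, \<open>m\<close>
  and the points may be chosen after the draw.\<close>

theorem theorem5p1:
  fixes n :: nat and a\<^sub>1 a\<^sub>2 :: real
  assumes "n \<ge> 1" and "0 < a\<^sub>1" and "a\<^sub>1 \<le> a\<^sub>2"
  shows "\<exists>A c. soft_O_one A \<and> soft_Theta_one c \<and>
    (\<forall>d>2. \<forall>H\<ge>1. \<forall>\<sigma> :: nat \<Rightarrow> real.
      (\<forall>k\<in>{1..d}. a\<^sub>1 / sqrt (real H) \<le> \<sigma> k \<and> \<sigma> k \<le> a\<^sub>2 / sqrt (real H)) \<longrightarrow>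
      (\<forall>\<delta>\<in>{0<..<1}.
        \<exists>E\<in>sets (xavier_measure n d H \<sigma>).
          measure (xavier_measure n d H \<sigma>) E \<ge> 1 - \<delta> \<and>
          (\<forall>\<omega>\<in>E. \<forall>r\<ge>0. \<forall>m\<ge>1. \<forall>x :: nat \<Rightarrow> real vec.
            (\<forall>i<m. x i \<in> carrier_vec n) \<longrightarrow>
            rademacher_complexity d (param_ball n d H (xavier_params n d H \<omega>) r) m x
              \<le> A H d m \<delta> *
                (real d * c H d m \<delta> ^ d * (r + 1) ^ d
                  * max 1 (Max ((\<lambda>i. euclidean_norm (x i)) ` {..<m})) / sqrt (real m)))))"
proof -
  let ?A = "\<lambda>(H::nat) (d::nat) (m::nat) (\<delta>::real). 2 :: real"
  \<comment> \<open>The sample size does not occur here, so one event, fixed before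
    \<open>m\<close>, serves all sample sizes.\<close>
  let ?s = "\<lambda>H d \<delta>. 1 + test_bound n a\<^sub>2 d \<delta> * (1 + ln (real (n * H)))"
  have A: "soft_O_one ?A"
    unfolding soft_O_one_def by (intro exI[of _ 2] exI[of _ 0]) simp
  have "\<exists>E\<in>sets (xavier_measure n d H \<sigma>). measure (xavier_measure n d H \<sigma>) E \<ge> 1 - \<delta> \<and>
      (\<forall>\<omega>\<in>E. \<forall>r\<ge>0. \<forall>m\<ge>1. \<forall>x :: nat \<Rightarrow> real vec. (\<forall>i<m. x i \<in> carrier_vec n) \<longrightarrow>
        rademacher_complexity d (param_ball n d H (xavier_params n d H \<omega>) r) m x
          \<le> 2 * (real d * ?s H d \<delta> ^ d * (r + 1) ^ d
              * max 1 (Max ((\<lambda>i. euclidean_norm (x i)) ` {..<m})) / sqrt (real m)))"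
    if d: "d > 2" and H: "H \<ge> 1" and \<delta>: "\<delta> \<in> {0<..<1}"
      and \<sigma>: "\<forall>k\<in>{1..d}. a\<^sub>1 / sqrt (real H) \<le> \<sigma> k \<and> \<sigma> k \<le> a\<^sub>2 / sqrt (real H)"
    for d H \<sigma> \<delta>
  proof -
    have d1: "d \<ge> 1" using d by simp
    \<comment> \<open>The lower bound on the deviations makes them positive, so that the normal
      densities are proper.\<close>
    have "0 < a\<^sub>1 / sqrt (real H)" using assms(2) H by simp
    then have \<sigma>': "0 < \<sigma> k \<and> \<sigma> k \<le> a\<^sub>2 / sqrt (real H)" if "k \<in> {1..d}" for k
      using \<sigma> that by fastforce
    obtain E where E1: "E \<in> sets (xavier_measure n d H \<sigma>)"
      and conj: "measure (xavier_measure n d H \<sigma>) E \<ge> 1 - \<delta> \<and> (\<forall>\<omega>\<in>E. \<forall>k<d. \<forall>y\<in>carrier_vec (layer_dim n d H k).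
        euclidean_norm (fst (xavier_params n d H \<omega>) (Suc k) *\<^sub>v y)
          \<le> test_bound n a\<^sub>2 d \<delta> * (1 + ln (real (n * H))) * euclidean_norm y)"
      by (rule bexE[OF xavier_operator_norm_bound[where \<sigma> = \<sigma>, OF assms(1) H d1 \<delta>]],
          erule \<sigma>', rule that)
    note E2 = conj[THEN conjunct1] and op = conj[THEN conjunct2]
    have s1: "?s H d \<delta> \<ge> 1"
      by (rule operator_bound_ge_1[OF assms(1) H d1 \<delta>])
    have "rademacher_complexity d (param_ball n d H (xavier_params n d H \<omega>) r) m x
        \<le> 2 * (real d * ?s H d \<delta> ^ d * (r + 1) ^ d
            * max 1 (Max ((\<lambda>i. euclidean_norm (x i)) ` {..<m})) / sqrt (real m))"
      if \<omega>: "\<omega> \<in> E" and r: "r \<ge> 0" and m: "m \<ge> 1" and x: "\<forall>i<m. x i \<in> carrier_vec n"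
      for \<omega> r m and x :: "nat \<Rightarrow> real vec"
    proof -
      let ?Z = "fst (xavier_params n d H \<omega>)"
      have Z: "xavier_params n d H \<omega> = (?Z, \<lambda>k. 0\<^sub>v (fan_out d H k))"
        by (simp add: xavier_params_def)
      show ?thesis
      proof (subst Z, rule rademacher_complexity_ball_le[OF _ _ s1 r d1 m])
        show "(?Z, \<lambda>k. 0\<^sub>v (fan_out d H k)) \<in> param_space n d H"
          using xavier_params_in_param_space[of n d H \<omega>] by (simp add: Z[symmetric])
        \<comment> \<open>The event gives this with \<open>?s - 1\<close> in place of
          \<open>?s\<close>; the additional norm of \<open>v\<close> only weakens it.\<close>
        show "euclidean_norm (?Z (Suc k) *\<^sub>v v) \<le> ?s H d \<delta> * euclidean_norm v"
          if "k < d" "v \<in> carrier_vec (layer_dim n d H k)" for k v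
          using op[rule_format, OF \<omega> that] by (simp only: distrib_right) (simp add: add_increasing)
      qed (use x in auto)
    qed
    then show ?thesis
      by (intro bexI[OF _ E1] conjI E2 ballI allI impI)
  qed
  then show ?thesis
    using A soft_Theta_one_operator_norm_bound[OF assms(1), of a\<^sub>2]
    by (intro exI[of _ ?A] exI[of _ "\<lambda>H d m \<delta>. ?s H d \<delta>"] conjI allI impI ballI)
qed

end
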